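(* Let $E,E_1$ be Banach spaces and let $\psi$ be a function on subsets (of $E$ and of $E_1$) with values in $[0,+\infty)$, not necessarily regular, which possesses the spherical property and the properties of semi-homogeneity, monotonicity, algebraic semi-additivity, nonsingularity and invariance under translations. (i) Let $u_1\in E$ and let $f\colon E\to E_1$ be a continuous operator (not necessarily linear) which in a neighborhood of $u_1$ has a representation $$f(u_1+u)=A_1(u)+A_0(u)\quad\text{for all } u\in E \text{ with } \|u\| \text{ sufficiently small},$$ where $A_0\colon E\to E_1$ is locally strongly $\psi$-condensing at the point $\theta$, and $A_1\colon E\to E_1$ is a continuous operator for which there is $0<k\leqslant 1$ with $\psi(A_1(\rho U))=\rho^k\psi(A_1(U))$ for all $U\subset E$ and all $\rho>0$. Then the following are equivalent: (a) $f\in(\lambda_0)$, i.e. $\psi(A_1(S_\rho))=0$ for all $\rho>0$; (b) $f\in(\lambda_2)$, i.e. $f$ is locally strongly $\psi$-condensing at $u_1$; (c) $f\in(\lambda_3)$, i.e. $f$ is locally strongly $\psi$-condensing at $u_1$ on spheres. (ii) Let $f\colon E\to E_1$ be a continuous operator (not necessarily linear) which in a neighborhood of infinity has a representation $$f(u)=\tilde A_1(u)+\tilde A_0(u)\quad\text{for all } u\in E \text{ with } \|u\| \text{ sufficiently large},$$ where $\tilde A_0\colon E\to E_1$ is strongly $\psi$-condensing at infinity on spherical interlayers, and $\tilde A_1\colon E\to E_1$ is a continuous operator for which there is $k\geqslant 1$ with $\psi(\tilde A_1(\rho U))=\rho^k\psi(\tilde A_1(U))$ for all $U\subset E$ and all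 $\rho>0$. Then the following are equivalent: (a) $f\in(\tilde\lambda_0)$, i.e. $\psi(\tilde A_1(S_\rho))=0$ for all $\rho>0$; (b) $f\in(\tilde\lambda_2)$, i.e. $f$ is strongly $\psi$-condensing at infinity on spherical interlayers; (c) $f\in(\tilde\lambda_3)$, i.e. $f$ is strongly $\psi$-condensing at infinity on spheres.
   Context: Notation: $\theta$ is the zero element; $S_\rho=\{u\in E:\|u\|=\rho\}$, $B_\rho=\{u\in E:\|u\|\leqslant\rho\}$. The function $\psi$ assigns a number in $[0,+\infty)$ to every subset of $E$ and to every subset of $E_1$ (written $\psi_E$, $\psi_{E_1}$ when the space must be specified). Its properties, required in each of the two spaces $X\in\{E,E_1\}$ for all subsets $U,V,U_1$ of $X$: semi-homogeneity: $\psi(tU)=|t|\psi(U)$ for every number $t$; monotonicity: $U_1\subseteq U$ implies $\psi(U_1)\leqslant\psi(U)$; algebraic semi-additivity: $\psi(U+V)\leqslant\psi(U)+\psi(V)$, where $U+V=\{u+v:u\in U,v\in V\}$; nonsingularity: $\psi$ vanishes on every one-element set; invariance under translations: $\psi(U+u)=\psi(U)$ for $u\in X$. ($\psi$ is called regular if $\psi(U)=0$ exactly when the closure of $U$ is compact; this is not assumed.) Spherical property: for every continuous map $T\colon E\to E_1$ (not necessarily linear) and every $\rho_1>0$, $\psi(T(B_{\rho_1}))>0$ if and only if there exists $\rho_0$ with $0<\rho_0\leqslant\rho_1$ and $\psi(T(S_{\rho_0}))>0$. Classes of continuous operators $f\colon E\to E_1$: Locally strongly $\psi$-condensing at a point $u_1\in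 E$ (class $(\lambda_2)$): there exist $r_1>0$ and a nonnegative function $\lambda_{u_1,f}$ on $[0,r_1]$ with $\lim_{r\to0}\lambda_{u_1,f}(r)=0$ such that $\psi_{E_1}(f(U))\leqslant\lambda_{u_1,f}(r)\,\psi_E(U)$ for all $0<\rho<r<r_1$ and $U=u_1+B_\rho$. Locally strongly $\psi$-condensing at $u_1$ on spheres (class $(\lambda_3)$): the same with $U=u_1+S_\rho$ instead of $U=u_1+B_\rho$. Strongly $\psi$-condensing at infinity on spherical interlayers (class $(\tilde\lambda_2)$): there exist $R_f>0$ and a nonnegative function $\tilde\lambda_f$ on $[R_f,\infty)$ with $\lim_{r\to\infty}\tilde\lambda_f(r)=0$ such that $\psi_{E_1}(f(U))\leqslant\tilde\lambda_f(R_1)\,\psi_E(U)$ for all $R_2>R_1>R_f$ and $U=B_{R_2}\setminus B_{R_1}$. Strongly $\psi$-condensing at infinity on spheres (class $(\tilde\lambda_3)$): the same with $U=S_{R_2}$ instead of $U=B_{R_2}\setminus B_{R_1}$. *)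

theory Defs
  imports "HOL-Analysis.Analysis"
begin

text \<open>
  \<open>psi_function\<close> collects the properties required of \<open>\<psi>\<close> in one space. The values lie in
  \<open>[0, \<infinity>]\<close> and are finite on bounded sets. If finiteness were demanded on all subsets,
  semi-homogeneity and monotonicity alone would force \<open>\<psi>\<close> to vanish identically
  (lemma \<open>everywhere_finite_imp_zero\<close>), since the whole space is invariant under scaling.
  Functions that take finite values on all subsets remain covered (lemma \<open>psi_function_ennreal\<close>).
  The value \<open>\<infinity>\<close> is needed because a continuous map may send a ball to an unbounded set.
\<close>

locale psi_function =
  fixes psi :: "'a::real_normed_vector set \<Rightarrow> ennreal"
  assumes finite_on_bounded: "bounded U \<Longrightarrow> psi U < \<infinity>"
    and semi_homogeneous: "psi ((\<lambda>u. t *\<^sub>R u) ` U) = ennreal \<bar>t\<bar> * psi U"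
    and monotone: "U1 \<subseteq> U \<Longrightarrow> psi U1 \<le> psi U"
    and semi_additive: "psi {u + v |u v. u \<in> U \<and> v \<in> V} \<le> psi U + psi V"
    and nonsingular: "psi {u} = 0"
    and translation_invariant: "psi ((\<lambda>v. v + u) ` U) = psi U"

lemma everywhere_finite_imp_zero:
  fixes phi :: "'a::real_normed_vector set \<Rightarrow> real"
  assumes nonneg: "\<And>U. 0 \<le> phi U"
    and hom: "\<And>t U. phi ((\<lambda>u. t *\<^sub>R u) ` U) = \<bar>t\<bar> * phi U"
    and mono: "\<And>U1 U. U1 \<subseteq> U \<Longrightarrow> phi U1 \<le> phi U"
  shows "phi U = 0"
proof -
  have "range (\<lambda>u::'a. 2 *\<^sub>R u) = UNIV"
    by (rule surjI[of _ "\<lambda>u. (1/2) *\<^sub>R u"]) simp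
  with hom[of 2 UNIV] have "phi UNIV = 0" by simp
  with mono[of U UNIV] nonneg[of U] show ?thesis by simp
qed

lemma psi_function_ennreal:
  fixes phi :: "'a::real_normed_vector set \<Rightarrow> real"
  assumes "\<And>U. 0 \<le> phi U"
    and "\<And>t U. phi ((\<lambda>u. t *\<^sub>R u) ` U) = \<bar>t\<bar> * phi U"
    and "\<And>U1 U. U1 \<subseteq> U \<Longrightarrow> phi U1 \<le> phi U"
    and "\<And>U V. phi {u + v |u v. u \<in> U \<and> v \<in> V} \<le> phi U + phi V"
    and "\<And>u. phi {u} = 0"
    and "\<And>u U. phi ((\<lambda>v. v + u) ` U) = phi U"
  shows "psi_function (\<lambda>U. ennreal (phi U))"
  by unfold_locales
    (use assms in \<open>auto simp: ennreal_mult simp flip: ennreal_plus intro!: ennreal_leI\<close>)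

text \<open>The first argument fixes the domain of the maps \<open>T\<close>.\<close>

definition spherical_property ::
  "'a::real_normed_vector itself \<Rightarrow> ('b::real_normed_vector set \<Rightarrow> ennreal) \<Rightarrow> bool" where
  "spherical_property _ psi \<longleftrightarrow>
    (\<forall>T :: 'a \<Rightarrow> 'b. continuous_on UNIV T \<longrightarrow>
      (\<forall>\<rho>1>0. psi (T ` cball 0 \<rho>1) > 0 \<longleftrightarrow>
        (\<exists>\<rho>0. 0 < \<rho>0 \<and> \<rho>0 \<le> \<rho>1 \<and> psi (T ` sphere 0 \<rho>0) > 0)))"

definition psi_homogeneous ::
  "('b::real_normed_vector set \<Rightarrow> ennreal) \<Rightarrow> real \<Rightarrow> ('a::real_normed_vector \<Rightarrow> 'b) \<Rightarrow> bool" where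
  "psi_homogeneous psi k A \<longleftrightarrow>
    (\<forall>U. \<forall>\<rho>>0. psi (A ` ((\<lambda>u. \<rho> *\<^sub>R u) ` U)) = ennreal (\<rho> powr k) * psi (A ` U))"

definition psi_null_on_spheres ::
  "('b::real_normed_vector set \<Rightarrow> ennreal) \<Rightarrow> ('a::real_normed_vector \<Rightarrow> 'b) \<Rightarrow> bool" where
  "psi_null_on_spheres psi A \<longleftrightarrow> (\<forall>\<rho>>0. psi (A ` sphere 0 \<rho>) = 0)"

definition locally_strongly_condensing ::
  "('a::real_normed_vector set \<Rightarrow> ennreal) \<Rightarrow> ('b::real_normed_vector set \<Rightarrow> ennreal) \<Rightarrow>
    'a \<Rightarrow> ('a \<Rightarrow> 'b) \<Rightarrow> bool" where
  "locally_strongly_condensing psiE psiE1 u1 f \<longleftrightarrow>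
    continuous_on UNIV f \<and>
    (\<exists>r1>0. \<exists>lam :: real \<Rightarrow> real.
      (\<forall>r\<in>{0..r1}. 0 \<le> lam r) \<and> (lam \<longlongrightarrow> 0) (at_right 0) \<and>
      (\<forall>\<rho> r. 0 < \<rho> \<and> \<rho> < r \<and> r < r1 \<longrightarrow>
        psiE1 (f ` ((\<lambda>u. u1 + u) ` cball 0 \<rho>))
          \<le> ennreal (lam r) * psiE ((\<lambda>u. u1 + u) ` cball 0 \<rho>)))"

definition locally_strongly_condensing_on_spheres ::
  "('a::real_normed_vector set \<Rightarrow> ennreal) \<Rightarrow> ('b::real_normed_vector set \<Rightarrow> ennreal) \<Rightarrow>
    'a \<Rightarrow> ('a \<Rightarrow> 'b) \<Rightarrow> bool" where
  "locally_strongly_condensing_on_spheres psiE psiE1 u1 f \<longleftrightarrow>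
    continuous_on UNIV f \<and>
    (\<exists>r1>0. \<exists>lam :: real \<Rightarrow> real.
      (\<forall>r\<in>{0..r1}. 0 \<le> lam r) \<and> (lam \<longlongrightarrow> 0) (at_right 0) \<and>
      (\<forall>\<rho> r. 0 < \<rho> \<and> \<rho> < r \<and> r < r1 \<longrightarrow>
        psiE1 (f ` ((\<lambda>u. u1 + u) ` sphere 0 \<rho>))
          \<le> ennreal (lam r) * psiE ((\<lambda>u. u1 + u) ` sphere 0 \<rho>)))"

definition strongly_condensing_at_infinity_on_interlayers ::
  "('a::real_normed_vector set \<Rightarrow> ennreal) \<Rightarrow> ('b::real_normed_vector set \<Rightarrow> ennreal) \<Rightarrow>
    ('a \<Rightarrow> 'b) \<Rightarrow> bool" where
  "strongly_condensing_at_infinity_on_interlayers psiE psiE1 f \<longleftrightarrow>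
    continuous_on UNIV f \<and>
    (\<exists>R>0. \<exists>lam :: real \<Rightarrow> real.
      (\<forall>r\<ge>R. 0 \<le> lam r) \<and> (lam \<longlongrightarrow> 0) at_top \<and>
      (\<forall>R1 R2. R < R1 \<and> R1 < R2 \<longrightarrow>
        psiE1 (f ` (cball 0 R2 - cball 0 R1))
          \<le> ennreal (lam R1) * psiE (cball 0 R2 - cball 0 R1)))"

definition strongly_condensing_at_infinity_on_spheres ::
  "('a::real_normed_vector set \<Rightarrow> ennreal) \<Rightarrow> ('b::real_normed_vector set \<Rightarrow> ennreal) \<Rightarrow>
    ('a \<Rightarrow> 'b) \<Rightarrow> bool" where
  "strongly_condensing_at_infinity_on_spheres psiE psiE1 f \<longleftrightarrow>
    continuous_on UNIV f \<and>
    (\<exists>R>0. \<exists>lam :: real \<Rightarrow> real.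
      (\<forall>r\<ge>R. 0 \<le> lam r) \<and> (lam \<longlongrightarrow> 0) at_top \<and>
      (\<forall>R1 R2. R < R1 \<and> R1 < R2 \<longrightarrow>
        psiE1 (f ` sphere 0 R2) \<le> ennreal (lam R1) * psiE (sphere 0 R2)))"

end

theory Submission
  imports Defs
begin

text \<open>
  In a nonzero space, every point of the ball \<open>B\<^sub>\<rho>\<close> is the midpoint of a point of the sphere \<open>S\<^sub>\<rho>\<close> and a point
  of \<open>B\<^sub>\<rho>\<close>, so \<open>\<psi>(B\<^sub>\<rho>) \<le> \<psi>(S\<^sub>\<rho>)/2 + \<psi>(B\<^sub>\<rho>)/2\<close> and hence
  \<open>\<psi>(B\<^sub>\<rho>) = \<psi>(S\<^sub>\<rho>)\<close>. Therefore each condensing condition on \<open>f\<close> gives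
  \<open>\<psi>(f(S\<^sub>\<rho>)) \<le> \<lambda> \<psi>(B\<^sub>\<rho>)\<close>. Subtracting \<open>A\<^sub>0\<close> and using homogeneity of degree \<open>k\<close> yields
  \<open>\<rho>\<^sup>k \<psi>(A\<^sub>1(S\<^sub>1)) \<le> \<lambda> \<rho> \<psi>(B\<^sub>1)\<close>, which forces \<open>\<psi>(A\<^sub>1(S\<^sub>1)) = 0\<close> because
  \<open>\<rho> \<le> \<rho>\<^sup>k\<close> in the relevant regime. Conversely, if \<open>A\<^sub>1\<close> is null on spheres, it is null on balls
  by the spherical property, and \<open>f\<close> inherits the estimate of \<open>A\<^sub>0\<close>.
\<close>

section \<open>Consequences of the axioms for \<open>psi\<close> in a single space\<close>

context psi_function
begin

lemma psi_image_add_le: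
  assumes "\<And>x. x \<in> U \<Longrightarrow> h x = f x + g x"
  shows "psi (h ` U) \<le> psi (f ` U) + psi (g ` U)"
proof -
  have "h ` U \<subseteq> {u + v |u v. u \<in> f ` U \<and> v \<in> g ` U}"
    using assms by blast
  then show ?thesis
    using monotone semi_additive order_trans by blast
qed

text \<open>Semi-homogeneity with factor \<open>-1\<close> gives \<open>- g\<close> and
  \<open>g\<close> the same value on \<open>U\<close>, so \<open>g\<close> can be moved to the other
  side although \<open>psi\<close> is only subadditive.\<close>

lemma psi_image_diff_le:
  assumes "\<And>x. x \<in> U \<Longrightarrow> h x = f x + g x"
  shows "psi (f ` U) \<le> psi (h ` U) + psi (g ` U)"
proof -
  have "psi ((\<lambda>x. - g x) ` U) = psi (g ` U)"
    using semi_homogeneous[of "-1" "g ` U"] by (simp add: image_image)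
  moreover have "psi (f ` U) \<le> psi (h ` U) + psi ((\<lambda>x. - g x) ` U)"
    by (rule psi_image_add_le) (use assms in simp)
  ultimately show ?thesis by simp
qed

lemma psi_left_translate: "psi ((\<lambda>v. u + v) ` U) = psi U"
  using translation_invariant[of u U] by (simp add: add.commute)

lemma psi_cball:
  assumes "\<rho> > 0"
  shows "psi (cball 0 \<rho>) = ennreal \<rho> * psi (cball 0 1)"
proof -
  have "(\<lambda>u. \<rho> *\<^sub>R u) ` cball 0 1 = cball (0::'a) \<rho>"
    using assms by (subst cball_scale) auto
  then show ?thesis
    using semi_homogeneous[of \<rho> "cball 0 1"] assms by simp
qed

lemma psi_cball_le_sphere:
  assumes "\<rho> > 0"
  shows "psi (cball 0 \<rho>) \<le> psi (sphere 0 \<rho>)"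
proof (cases "\<exists>x::'a. x \<noteq> 0")
  \<comment> \<open>In the zero space the sphere is empty, so the midpoint argument fails; the ball
    is a single point and nonsingularity takes over.\<close>
  case False
  then have "cball (0::'a) \<rho> \<subseteq> {0}" by blast
  then have "psi (cball 0 \<rho>) \<le> psi {0}" by (rule monotone)
  then show ?thesis by (simp add: nonsingular)
next
  case True
  then obtain x :: 'a where "x \<noteq> 0" by blast
  let ?half = "\<lambda>u::'a. (1/2) *\<^sub>R u"
  let ?B = "cball (0::'a) \<rho>" and ?S = "sphere (0::'a) \<rho>"
  have "?B \<subseteq> {u + v |u v. u \<in> ?half ` ?S \<and> v \<in> ?half ` ?B}"
  proof
    fix v assume v: "v \<in> ?B"
    \<comment> \<open>\<open>e\<close> is the direction of \<open>v\<close>; for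
      \<open>v = 0\<close> any unit vector serves, and the nonzero \<open>x\<close> supplies
      one.\<close>
    obtain e where e: "norm e = 1" "v = norm v *\<^sub>R e"
    proof (cases "v = 0")
      case True
      then show ?thesis using that[of "sgn x"] \<open>x \<noteq> 0\<close> by (simp add: norm_sgn)
    next
      case False
      then show ?thesis using that[of "sgn v"] by (simp add: norm_sgn sgn_div_norm)
    qed
    \<comment> \<open>The reflection of the sphere point \<open>\<rho> *\<^sub>R e\<close> in
      \<open>v\<close> stays on the line of \<open>e\<close>, so lying in the ball reduces to a
      bound on one real coordinate.\<close>
    have "2 *\<^sub>R v - \<rho> *\<^sub>R e = (2 * norm v - \<rho>) *\<^sub>R e"
      by (subst e(2)) (simp add: scaleR_diff_left)
    then have "norm (2 *\<^sub>R v - \<rho> *\<^sub>R e) = \<bar>2 * norm v - \<rho>\<bar>"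
      using e(1) by simp
    moreover have "norm v \<le> \<rho>"
      using v by simp
    then have "\<bar>2 * norm v - \<rho>\<bar> \<le> \<rho>"
      using norm_ge_zero[of v] by linarith
    ultimately have "2 *\<^sub>R v - \<rho> *\<^sub>R e \<in> ?B" "\<rho> *\<^sub>R e \<in> ?S"
      using v e(1) assms by auto
    moreover have "v = ?half (\<rho> *\<^sub>R e) + ?half (2 *\<^sub>R v - \<rho> *\<^sub>R e)"
      by (simp add: scaleR_diff_right)
    ultimately show "v \<in> {u + v |u v. u \<in> ?half ` ?S \<and> v \<in> ?half ` ?B}"
      by blast
  qed
  then have "psi ?B \<le> psi (?half ` ?S) + psi (?half ` ?B)"
    using monotone semi_additive order_trans by blast
  then have *: "psi ?B \<le> ennreal (1/2) * psi ?S + ennreal (1/2) * psi ?B"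
    by (simp add: semi_homogeneous)
  define h :: real where "h = 1/2"
  have h_nonneg: "0 \<le> h" by (simp add: h_def)
  \<comment> \<open>Finiteness is essential: the inequality passes to real numbers, where half of
    \<open>b\<close> can be cancelled. An infinite value would leave it void.\<close>
  have "psi ?B < \<infinity>" by (rule finite_on_bounded) simp
  moreover have "?S \<subseteq> ?B" by auto
  then have "psi ?S \<le> psi ?B" by (rule monotone)
  ultimately obtain b s where "psi ?B = ennreal b" "psi ?S = ennreal s" "0 \<le> b" "0 \<le> s"
    by (cases "psi ?B"; cases "psi ?S") (auto simp: top_unique)
  with * have "b \<le> h * s + h * b"
    unfolding h_def[symmetric]
    by (simp add: ennreal_mult[symmetric] ennreal_plus[symmetric] h_nonneg del: ennreal_plus)
  with \<open>psi ?B = ennreal b\<close> \<open>psi ?S = ennreal s\<close> show ?thesis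
    by (simp add: h_def ennreal_leI)
qed

end

section \<open>Null operators and homogeneous operators\<close>

lemma psi_null_on_spheres_imp_cball:
  fixes A :: "'a::real_normed_vector \<Rightarrow> 'b::real_normed_vector"
  assumes "spherical_property TYPE('a) psi" "continuous_on UNIV A"
    and "psi_null_on_spheres psi A" "\<rho> > 0"
  shows "psi (A ` cball 0 \<rho>) = 0"
proof (rule ccontr)
  assume "psi (A ` cball 0 \<rho>) \<noteq> 0"
  then have "psi (A ` cball 0 \<rho>) > 0"
    by (simp add: zero_less_iff_neq_zero)
  then obtain \<rho>0 where "0 < \<rho>0" "psi (A ` sphere 0 \<rho>0) > 0"
    using assms unfolding spherical_property_def by blast
  then show False
    using assms(3) by (simp add: psi_null_on_spheres_def)
qed

text \<open>On any subset of a ball, \<open>A1\<close> contributes \<open>0\<close> to the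
  semi-additive bound. This transfers estimates for \<open>A0\<close> to \<open>f\<close> on balls,
  spheres and interlayers alike.\<close>

lemma psi_image_null_add_le:
  fixes A1 :: "'a::real_normed_vector \<Rightarrow> 'b::real_normed_vector"
  assumes "psi_function psi" "spherical_property TYPE('a) psi" "continuous_on UNIV A1"
    and "psi_null_on_spheres psi A1" "\<rho> > 0" "U \<subseteq> cball 0 \<rho>"
    and "\<And>x. x \<in> U \<Longrightarrow> f x = A1 x + A0 x"
  shows "psi (f ` U) \<le> psi (A0 ` U)"
proof -
  interpret psi_function psi by fact
  have "psi (A1 ` U) \<le> psi (A1 ` cball 0 \<rho>)"
    using assms(6) by (intro monotone image_mono)
  also have "\<dots> = 0"
    using assms(2-5) by (rule psi_null_on_spheres_imp_cball)
  finally show ?thesis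
    using psi_image_add_le[of U f A1 A0] assms(7) by simp
qed

lemma psi_homogeneous_sphere:
  fixes A :: "'a::real_normed_vector \<Rightarrow> 'b::real_normed_vector"
  assumes "psi_homogeneous psi k A" "\<rho> > 0"
  shows "psi (A ` sphere 0 \<rho>) = ennreal (\<rho> powr k) * psi (A ` sphere 0 1)"
proof -
  have "(\<lambda>u. \<rho> *\<^sub>R u) ` sphere 0 1 = sphere (0::'a) \<rho>"
    using assms(2) by (subst sphere_scale) auto
  then show ?thesis
    using assms unfolding psi_homogeneous_def by metis
qed

text \<open>Scaling both sides to radius 1 leaves a fixed quantity bounded by a null sequence times
  a constant. The filter \<open>F\<close> is general so that radii tending to \<open>0\<close> and
  to infinity share one argument.\<close>

lemma psi_null_on_spheres_if_estimate:
  fixes A :: "'a::real_normed_vector \<Rightarrow> 'b::real_normed_vector"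
  assumes "psi_function psiE" and hom: "psi_homogeneous psi k A"
    and F: "F \<noteq> bot" "(lam \<longlongrightarrow> 0) F"
    and est: "\<forall>\<^sub>F x in F. 0 < \<rho> x \<and> \<rho> x \<le> \<rho> x powr k \<and>
      psi (A ` sphere 0 (\<rho> x)) \<le> ennreal (lam x) * psiE (cball 0 (\<rho> x))"
  shows "psi_null_on_spheres psi A"
proof -
  interpret psi_function psiE by fact
  let ?a = "psi (A ` sphere 0 1)" and ?b = "psiE (cball 0 1)"
  have "\<forall>\<^sub>F x in F. ?a \<le> ennreal (lam x) * ?b"
    using est
  proof eventually_elim
    case (elim x)
    \<comment> \<open>Trading the power for \<open>\<rho> x\<close> itself gives both sides the same
      factor, which is positive and finite and hence cancels.\<close>
    have "ennreal (\<rho> x) * ?a \<le> ennreal (\<rho> x powr k) * ?a"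
      using elim by (intro mult_right_mono ennreal_leI) auto
    also have "\<dots> = psi (A ` sphere 0 (\<rho> x))"
      using elim by (simp add: psi_homogeneous_sphere[OF hom, of "\<rho> x"])
    also have "\<dots> \<le> ennreal (lam x) * psiE (cball 0 (\<rho> x))"
      using elim by simp
    also have "\<dots> = ennreal (\<rho> x) * (ennreal (lam x) * ?b)"
      using elim by (simp add: psi_cball[of "\<rho> x"] ac_simps)
    finally show ?case
      using elim by (simp add: ennreal_mult_le_mult_iff)
  qed
  then have "\<forall>\<^sub>F x in F. ?a \<le> ?b * ennreal (lam x)"
    by (simp add: mult.commute)
  \<comment> \<open>With \<open>?b\<close> finite, the bound tends to \<open>0\<close> along with
    \<open>lam\<close>.\<close>
  moreover have "?b < top"
    using finite_on_bounded[of "cball 0 1"] by simp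
  then have "((\<lambda>x. ?b * ennreal (lam x)) \<longlongrightarrow> ?b * ennreal 0) F"
    using F(2) by (intro ennreal_tendsto_cmult tendsto_ennrealI)
  ultimately have "?a \<le> ?b * ennreal 0"
    using F(1) by (intro tendsto_lowerbound)
  then have "?a = 0" by simp
  show ?thesis
    unfolding psi_null_on_spheres_def
  proof (intro allI impI)
    fix r :: real assume "0 < r"
    then show "psi (A ` sphere 0 r) = 0"
      using psi_homogeneous_sphere[OF hom, of r] \<open>?a = 0\<close> by simp
  qed
qed

section \<open>A common weakening of the ball, interlayer and sphere conditions\<close>

text \<open>Since the sphere lies in the ball, monotonicity shrinks the image side of the ball
  condition and enlarges the right side of the sphere condition. Both then yield one estimate,
  enough to force nullness.\<close>

lemma locally_strongly_condensing_cball_estimate: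
  assumes "psi_function psiE" "psi_function psiE1"
    and "locally_strongly_condensing psiE psiE1 u1 f \<or>
      locally_strongly_condensing_on_spheres psiE psiE1 u1 f"
  obtains r1 lam where "r1 > 0" "(lam \<longlongrightarrow> 0) (at_right 0)" "\<And>r. r \<in> {0..r1} \<Longrightarrow> 0 \<le> lam r"
    "\<And>\<rho> r. 0 < \<rho> \<Longrightarrow> \<rho> < r \<Longrightarrow> r < r1 \<Longrightarrow>
      psiE1 ((\<lambda>u. f (u1 + u)) ` sphere 0 \<rho>) \<le> ennreal (lam r) * psiE (cball 0 \<rho>)"
proof -
  interpret E: psi_function psiE by fact
  interpret E1: psi_function psiE1 by fact
  have 1: "psiE1 ((\<lambda>u. f (u1 + u)) ` sphere 0 \<rho>) \<le> psiE1 ((\<lambda>u. f (u1 + u)) ` cball 0 \<rho>)" for \<rho>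
    by (intro E1.monotone image_mono sphere_cball)
  have 2: "c * psiE (sphere 0 \<rho>) \<le> c * psiE (cball 0 \<rho>)" for \<rho> c
    by (intro mult_left_mono E.monotone sphere_cball) simp
  from assms(3) show ?thesis
  proof
    assume "locally_strongly_condensing psiE psiE1 u1 f"
    then obtain r1 lam where "r1 > 0" "\<forall>r\<in>{0..r1}. 0 \<le> lam r" "(lam \<longlongrightarrow> 0) (at_right 0)"
      and *: "\<And>\<rho> r. 0 < \<rho> \<Longrightarrow> \<rho> < r \<Longrightarrow> r < r1 \<Longrightarrow>
        psiE1 ((\<lambda>u. f (u1 + u)) ` cball 0 \<rho>) \<le> ennreal (lam r) * psiE (cball 0 \<rho>)"
      unfolding locally_strongly_condensing_def image_image E.psi_left_translate by blast
    then show ?thesis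
      using that[of r1 lam] order_trans[OF 1 *] by blast
  next
    assume "locally_strongly_condensing_on_spheres psiE psiE1 u1 f"
    then obtain r1 lam where "r1 > 0" "\<forall>r\<in>{0..r1}. 0 \<le> lam r" "(lam \<longlongrightarrow> 0) (at_right 0)"
      and *: "\<And>\<rho> r. 0 < \<rho> \<Longrightarrow> \<rho> < r \<Longrightarrow> r < r1 \<Longrightarrow>
        psiE1 ((\<lambda>u. f (u1 + u)) ` sphere 0 \<rho>) \<le> ennreal (lam r) * psiE (sphere 0 \<rho>)"
      unfolding locally_strongly_condensing_on_spheres_def image_image E.psi_left_translate
      by blast
    then show ?thesis
      using that[of r1 lam] order_trans[OF * 2] by blast
  qed
qed

text \<open>The interlayer contains its outer sphere because \<open>R1 < R2\<close>, and is
  contained in the outer ball; monotonicity does the rest.\<close>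

lemma strongly_condensing_at_infinity_cball_estimate:
  assumes "psi_function psiE" "psi_function psiE1"
    and "strongly_condensing_at_infinity_on_interlayers psiE psiE1 f \<or>
      strongly_condensing_at_infinity_on_spheres psiE psiE1 f"
  obtains R lam where "R > 0" "(lam \<longlongrightarrow> 0) at_top" "\<And>r. r \<ge> R \<Longrightarrow> 0 \<le> lam r"
    "\<And>R1 R2. R < R1 \<Longrightarrow> R1 < R2 \<Longrightarrow>
      psiE1 (f ` sphere 0 R2) \<le> ennreal (lam R1) * psiE (cball 0 R2)"
proof -
  interpret E: psi_function psiE by fact
  interpret E1: psi_function psiE1 by fact
  have 1: "psiE1 (f ` sphere 0 R2) \<le> psiE1 (f ` (cball 0 R2 - cball 0 R1))" if "R1 < R2" for R1 R2
    using that by (intro E1.monotone image_mono) auto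
  have 2: "c * psiE (sphere 0 R2) \<le> c * psiE (cball 0 R2)" for R2 c
    by (intro mult_left_mono E.monotone sphere_cball) simp
  have 3: "c * psiE (cball 0 R2 - cball 0 R1) \<le> c * psiE (cball 0 R2)" for R1 R2 c
    by (intro mult_left_mono E.monotone) auto
  from assms(3) show ?thesis
  proof
    assume "strongly_condensing_at_infinity_on_interlayers psiE psiE1 f"
    then obtain R lam where "R > 0" "\<forall>r\<ge>R. 0 \<le> lam r" "(lam \<longlongrightarrow> 0) at_top"
      and *: "\<And>R1 R2. R < R1 \<Longrightarrow> R1 < R2 \<Longrightarrow> psiE1 (f ` (cball 0 R2 - cball 0 R1))
          \<le> ennreal (lam R1) * psiE (cball 0 R2 - cball 0 R1)"
      unfolding strongly_condensing_at_infinity_on_interlayers_def by blast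
    then show ?thesis
      using that[of R lam] order_trans[OF 1 order_trans[OF * 3]] by blast
  next
    assume "strongly_condensing_at_infinity_on_spheres psiE psiE1 f"
    then obtain R lam where "R > 0" "\<forall>r\<ge>R. 0 \<le> lam r" "(lam \<longlongrightarrow> 0) at_top"
      and *: "\<And>R1 R2. R < R1 \<Longrightarrow> R1 < R2 \<Longrightarrow>
        psiE1 (f ` sphere 0 R2) \<le> ennreal (lam R1) * psiE (sphere 0 R2)"
      unfolding strongly_condensing_at_infinity_on_spheres_def by blast
    then show ?thesis
      using that[of R lam] order_trans[OF * 2] by blast
  qed
qed

section \<open>The local case\<close>

lemma locally_strongly_condensing_if_null:
  fixes f :: "'a::real_normed_vector \<Rightarrow> 'b::real_normed_vector"
  assumes "psi_function psiE" "psi_function psiE1" "spherical_property TYPE('a) psiE1"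
    and cont: "continuous_on UNIV f" "continuous_on UNIV A1"
    and "\<delta> > 0" and rep: "\<And>u. norm u < \<delta> \<Longrightarrow> f (u1 + u) = A1 u + A0 u"
    and A0: "locally_strongly_condensing psiE psiE1 0 A0"
    and null: "psi_null_on_spheres psiE1 A1"
  shows "locally_strongly_condensing psiE psiE1 u1 f"
    and "locally_strongly_condensing_on_spheres psiE psiE1 u1 f"
proof -
  interpret E: psi_function psiE by fact
  interpret E1: psi_function psiE1 by fact
  obtain r1 lam where r1: "r1 > 0" "\<forall>r\<in>{0..r1}. 0 \<le> lam r" "(lam \<longlongrightarrow> 0) (at_right 0)"
    and est: "\<And>\<rho> r. 0 < \<rho> \<Longrightarrow> \<rho> < r \<Longrightarrow> r < r1 \<Longrightarrow>
      psiE1 (A0 ` cball 0 \<rho>) \<le> ennreal (lam r) * psiE (cball 0 \<rho>)"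
    using A0 unfolding locally_strongly_condensing_def by auto
  define r2 where "r2 = min r1 \<delta>"
  have r2: "r2 > 0" "r2 \<le> r1" "r2 \<le> \<delta>"
    using r1(1) \<open>\<delta> > 0\<close> by (auto simp: r2_def)
  \<comment> \<open>\<open>U\<close> is left arbitrary so that the ball and the sphere are both
    instances.\<close>
  have le: "psiE1 ((\<lambda>u. f (u1 + u)) ` U) \<le> ennreal (lam r) * psiE (cball 0 \<rho>)"
    if "0 < \<rho>" "\<rho> < r" "r < r2" "U \<subseteq> cball 0 \<rho>" for U \<rho> r
  proof -
    have "norm x < \<delta>" if "x \<in> U" for x
    proof -
      have "norm x \<le> \<rho>" using that \<open>U \<subseteq> cball 0 \<rho>\<close> by auto
      then show ?thesis using \<open>\<rho> < r\<close> \<open>r < r2\<close> r2 by linarith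
    qed
    then have "psiE1 ((\<lambda>u. f (u1 + u)) ` U) \<le> psiE1 (A0 ` U)"
      using that rep
      by (intro psi_image_null_add_le[OF assms(2,3) cont(2) null]) auto
    also have "\<dots> \<le> psiE1 (A0 ` cball 0 \<rho>)"
      using that by (intro E1.monotone image_mono)
    also have "\<dots> \<le> ennreal (lam r) * psiE (cball 0 \<rho>)"
      using that r2 by (intro est) auto
    finally show ?thesis .
  qed
  have r: "\<forall>r\<in>{0..r2}. 0 \<le> lam r"
    using r1(2) r2 by auto
  show "locally_strongly_condensing psiE psiE1 u1 f"
    unfolding locally_strongly_condensing_def image_image E.psi_left_translate
    using cont(1) r r1(3) r2(1) le by blast
  \<comment> \<open>Here monotonicity points the wrong way: replacing the ball by the sphere on the
    right rests on \<open>psi_cball_le_sphere\<close>.\<close>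
  have "psiE1 ((\<lambda>u. f (u1 + u)) ` sphere 0 \<rho>) \<le> ennreal (lam r) * psiE (sphere 0 \<rho>)"
    if "0 < \<rho>" "\<rho> < r" "r < r2" for \<rho> r
    using le[OF that sphere_cball] mult_left_mono[OF E.psi_cball_le_sphere[OF that(1)]]
    by (meson order_trans zero_le)
  then show "locally_strongly_condensing_on_spheres psiE psiE1 u1 f"
    unfolding locally_strongly_condensing_on_spheres_def image_image E.psi_left_translate
    using cont(1) r r1(3) r2(1) by blast
qed

lemma null_if_locally_strongly_condensing:
  fixes f :: "'a::real_normed_vector \<Rightarrow> 'b::real_normed_vector"
  assumes psi: "psi_function psiE" "psi_function psiE1"
    and "\<delta> > 0" and rep: "\<And>u. norm u < \<delta> \<Longrightarrow> f (u1 + u) = A1 u + A0 u"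
    and A0: "locally_strongly_condensing psiE psiE1 0 A0"
    and hom: "k \<le> 1" "psi_homogeneous psiE1 k A1"
    and f: "locally_strongly_condensing psiE psiE1 u1 f \<or>
      locally_strongly_condensing_on_spheres psiE psiE1 u1 f"
  shows "psi_null_on_spheres psiE1 A1"
proof -
  interpret E1: psi_function psiE1 by fact
  obtain r0 lam0 where 0: "r0 > 0" "(lam0 \<longlongrightarrow> 0) (at_right 0)"
    "\<And>r. r \<in> {0..r0} \<Longrightarrow> 0 \<le> lam0 r"
    "\<And>\<rho> r. 0 < \<rho> \<Longrightarrow> \<rho> < r \<Longrightarrow> r < r0 \<Longrightarrow>
      psiE1 ((\<lambda>u. A0 (0 + u)) ` sphere 0 \<rho>) \<le> ennreal (lam0 r) * psiE (cball 0 \<rho>)"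
    using locally_strongly_condensing_cball_estimate[OF psi disjI1[OF A0]] by blast
  obtain r1 lam1 where 1: "r1 > 0" "(lam1 \<longlongrightarrow> 0) (at_right 0)"
    "\<And>r. r \<in> {0..r1} \<Longrightarrow> 0 \<le> lam1 r"
    "\<And>\<rho> r. 0 < \<rho> \<Longrightarrow> \<rho> < r \<Longrightarrow> r < r1 \<Longrightarrow>
      psiE1 ((\<lambda>u. f (u1 + u)) ` sphere 0 \<rho>) \<le> ennreal (lam1 r) * psiE (cball 0 \<rho>)"
    using locally_strongly_condensing_cball_estimate[OF psi f] by blast
  have "((\<lambda>r. lam1 r + lam0 r) \<longlongrightarrow> 0) (at_right 0)"
    using tendsto_add[OF 1(2) 0(2)] by simp
  \<comment> \<open>The definitions require a radius strictly below the argument of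
    \<open>lam\<close>; \<open>r / 2\<close> is one such choice.\<close>
  moreover have "\<forall>\<^sub>F r in at_right 0. 0 < r / 2 \<and> r / 2 \<le> (r / 2) powr k \<and>
      psiE1 (A1 ` sphere 0 (r / 2)) \<le> ennreal (lam1 r + lam0 r) * psiE (cball 0 (r / 2))"
  proof -
    \<comment> \<open>The bound 1 makes radii small enough that a power with exponent
      \<open>k \<le> 1\<close> does not decrease them.\<close>
    define m where "m = min (min r0 r1) (min \<delta> 1)"
    have "m > 0" using 0(1) 1(1) \<open>\<delta> > 0\<close> by (simp add: m_def)
    then have "\<forall>\<^sub>F r in at_right 0. r \<in> {0<..<m}"
      by (rule eventually_at_right_real)
    then show ?thesis
    proof eventually_elim
      case (elim r)
      then have r: "0 < r" "r < r0" "r < r1" "r < \<delta>" "r < 1"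
        by (auto simp: m_def)
      have "psiE1 (A1 ` sphere 0 (r / 2))
          \<le> psiE1 ((\<lambda>u. f (u1 + u)) ` sphere 0 (r / 2)) + psiE1 (A0 ` sphere 0 (r / 2))"
        using r by (intro E1.psi_image_diff_le rep) auto
      also have "\<dots> \<le> ennreal (lam1 r) * psiE (cball 0 (r / 2))
          + ennreal (lam0 r) * psiE (cball 0 (r / 2))"
        using 0(4)[of "r/2" r] 1(4)[of "r/2" r] r by (intro add_mono) auto
      \<comment> \<open>Nonnegativity of both functions is used: \<open>ennreal\<close> truncates
        negative reals and is additive only on nonnegative ones.\<close>
      also have "\<dots> = ennreal (lam1 r + lam0 r) * psiE (cball 0 (r / 2))"
        using 0(3)[of r] 1(3)[of r] r by (simp add: distrib_right)
      finally have "psiE1 (A1 ` sphere 0 (r / 2))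
        \<le> ennreal (lam1 r + lam0 r) * psiE (cball 0 (r / 2))" .
      moreover have "r / 2 \<le> (r / 2) powr k"
        using powr_mono'[OF hom(1), of "r / 2"] r by simp
      ultimately show ?case using r by simp
    qed
  qed
  ultimately show ?thesis
    by (rule psi_null_on_spheres_if_estimate[OF psi(1) hom(2) trivial_limit_at_right_real])
qed

section \<open>The case of infinity\<close>

lemma strongly_condensing_at_infinity_if_null:
  fixes f :: "'a::real_normed_vector \<Rightarrow> 'b::real_normed_vector"
  assumes "psi_function psiE" "psi_function psiE1" "spherical_property TYPE('a) psiE1"
    and cont: "continuous_on UNIV f" "continuous_on UNIV A1"
    and rep: "\<And>u. norm u > R0 \<Longrightarrow> f u = A1 u + A0 u"
    and A0: "strongly_condensing_at_infinity_on_interlayers psiE psiE1 A0"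
    and null: "psi_null_on_spheres psiE1 A1"
  shows "strongly_condensing_at_infinity_on_interlayers psiE psiE1 f"
    and "strongly_condensing_at_infinity_on_spheres psiE psiE1 f"
proof -
  interpret E: psi_function psiE by fact
  interpret E1: psi_function psiE1 by fact
  obtain R lam where R: "R > 0" "\<forall>r\<ge>R. 0 \<le> lam r" "(lam \<longlongrightarrow> 0) at_top"
    and est: "\<And>R1 R2. R < R1 \<Longrightarrow> R1 < R2 \<Longrightarrow> psiE1 (A0 ` (cball 0 R2 - cball 0 R1))
          \<le> ennreal (lam R1) * psiE (cball 0 R2 - cball 0 R1)"
    using A0 unfolding strongly_condensing_at_infinity_on_interlayers_def by blast
  \<comment> \<open>\<open>R0\<close> may be negative; the maximum with \<open>R\<close> keeps the
    threshold positive.\<close>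
  define R' where "R' = max R R0"
  have R': "R' > 0" "R \<le> R'" "R0 \<le> R'"
    using R(1) by (auto simp: R'_def)
  have le: "psiE1 (f ` (cball 0 R2 - cball 0 R1))
      \<le> ennreal (lam R1) * psiE (cball 0 R2 - cball 0 R1)"
    if "R' < R1" "R1 < R2" for R1 R2
  proof -
    have "psiE1 (f ` (cball 0 R2 - cball 0 R1)) \<le> psiE1 (A0 ` (cball 0 R2 - cball 0 R1))"
      using that R' rep
      by (intro psi_image_null_add_le[OF assms(2,3) cont(2) null, of R2]) auto
    also have "\<dots> \<le> ennreal (lam R1) * psiE (cball 0 R2 - cball 0 R1)"
      using that R' by (intro est) auto
    finally show ?thesis .
  qed
  have r: "\<forall>r\<ge>R'. 0 \<le> lam r"
    using R(2) R' by auto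
  show interlayers: "strongly_condensing_at_infinity_on_interlayers psiE psiE1 f"
    unfolding strongly_condensing_at_infinity_on_interlayers_def
    using cont(1) r R(3) R'(1) le by blast
  \<comment> \<open>The sphere condition is drawn from the interlayer condition just proved for
    \<open>f\<close>: outer spheres inherit a bound by the ball, which the sphere dominates.\<close>
  obtain R lam where "R > 0" "(lam \<longlongrightarrow> 0) at_top" "\<And>r. r \<ge> R \<Longrightarrow> 0 \<le> lam r"
    and "\<And>R1 R2. R < R1 \<Longrightarrow> R1 < R2 \<Longrightarrow>
      psiE1 (f ` sphere 0 R2) \<le> ennreal (lam R1) * psiE (cball 0 R2)"
    using strongly_condensing_at_infinity_cball_estimate[OF assms(1,2) disjI1[OF interlayers]]
    by blast
  moreover from this have "psiE1 (f ` sphere 0 R2) \<le> ennreal (lam R1) * psiE (sphere 0 R2)"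
    if "R < R1" "R1 < R2" for R1 R2
    using that mult_left_mono[OF E.psi_cball_le_sphere[of R2], of "ennreal (lam R1)"]
    by (meson order_trans order_less_trans zero_le)
  ultimately show "strongly_condensing_at_infinity_on_spheres psiE psiE1 f"
    unfolding strongly_condensing_at_infinity_on_spheres_def
    using cont(1) by blast
qed

lemma null_if_strongly_condensing_at_infinity:
  fixes f :: "'a::real_normed_vector \<Rightarrow> 'b::real_normed_vector"
  assumes psi: "psi_function psiE" "psi_function psiE1"
    and rep: "\<And>u. norm u > R \<Longrightarrow> f u = A1 u + A0 u"
    and A0: "strongly_condensing_at_infinity_on_interlayers psiE psiE1 A0"
    and hom: "k \<ge> 1" "psi_homogeneous psiE1 k A1"
    and f: "strongly_condensing_at_infinity_on_interlayers psiE psiE1 f \<or>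
      strongly_condensing_at_infinity_on_spheres psiE psiE1 f"
  shows "psi_null_on_spheres psiE1 A1"
proof -
  interpret E1: psi_function psiE1 by fact
  obtain R0 lam0 where 0: "R0 > 0" "(lam0 \<longlongrightarrow> 0) at_top" "\<And>r. r \<ge> R0 \<Longrightarrow> 0 \<le> lam0 r"
    "\<And>R1 R2. R0 < R1 \<Longrightarrow> R1 < R2 \<Longrightarrow>
      psiE1 (A0 ` sphere 0 R2) \<le> ennreal (lam0 R1) * psiE (cball 0 R2)"
    using strongly_condensing_at_infinity_cball_estimate[OF psi disjI1[OF A0]] by blast
  obtain R1 lam1 where 1: "R1 > 0" "(lam1 \<longlongrightarrow> 0) at_top" "\<And>r. r \<ge> R1 \<Longrightarrow> 0 \<le> lam1 r"
    "\<And>R' R2. R1 < R' \<Longrightarrow> R' < R2 \<Longrightarrow>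
      psiE1 (f ` sphere 0 R2) \<le> ennreal (lam1 R') * psiE (cball 0 R2)"
    using strongly_condensing_at_infinity_cball_estimate[OF psi f] by blast
  have "((\<lambda>r. lam1 r + lam0 r) \<longlongrightarrow> 0) at_top"
    using tendsto_add[OF 1(2) 0(2)] by simp
  \<comment> \<open>The shift by 1 provides an outer radius strictly above \<open>r\<close> and, for
    \<open>r > 0\<close>, above 1, where a power with exponent \<open>k \<ge> 1\<close> does not
    decrease it.\<close>
  moreover have "\<forall>\<^sub>F r in at_top. 0 < r + 1 \<and> r + 1 \<le> (r + 1) powr k \<and>
      psiE1 (A1 ` sphere 0 (r + 1)) \<le> ennreal (lam1 r + lam0 r) * psiE (cball 0 (r + 1))"
    using eventually_gt_at_top[of "max R (max R0 R1)"]
  proof eventually_elim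
    case (elim r)
    then have r: "0 < r" "R0 < r" "R1 < r" "R < r"
      using 0(1) by auto
    have "psiE1 (A1 ` sphere 0 (r + 1))
        \<le> psiE1 (f ` sphere 0 (r + 1)) + psiE1 (A0 ` sphere 0 (r + 1))"
      using r by (intro E1.psi_image_diff_le rep) auto
    also have "\<dots> \<le> ennreal (lam1 r) * psiE (cball 0 (r + 1))
        + ennreal (lam0 r) * psiE (cball 0 (r + 1))"
      using r by (intro add_mono 0(4) 1(4)) auto
    also have "\<dots> = ennreal (lam1 r + lam0 r) * psiE (cball 0 (r + 1))"
      using 0(3)[of r] 1(3)[of r] r by (simp add: distrib_right)
    finally have "psiE1 (A1 ` sphere 0 (r + 1))
      \<le> ennreal (lam1 r + lam0 r) * psiE (cball 0 (r + 1))" .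
    moreover have "r + 1 \<le> (r + 1) powr k"
      using powr_mono[OF hom(1), of "r + 1"] r by simp
    ultimately show ?case using r by simp
  qed
  ultimately show ?thesis
    by (rule psi_null_on_spheres_if_estimate[OF psi(1) hom(2) trivial_limit_at_top_linorder])
qed

theorem theorem1:
  fixes psiE :: "'a::banach set \<Rightarrow> ennreal"
    and psiE1 :: "'b::banach set \<Rightarrow> ennreal"
  assumes "psi_function psiE" and "psi_function psiE1"
    and "spherical_property TYPE('a) psiE1"
  shows "(\<forall>(u1::'a) (f::'a \<Rightarrow> 'b) A1 A0.
      continuous_on UNIV f \<and>
      (\<exists>\<delta>>0. \<forall>u. norm u < \<delta> \<longrightarrow> f (u1 + u) = A1 u + A0 u) \<and>
      locally_strongly_condensing psiE psiE1 0 A0 \<and>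
      continuous_on UNIV A1 \<and>
      (\<exists>k. 0 < k \<and> k \<le> 1 \<and> psi_homogeneous psiE1 k A1) \<longrightarrow>
      (psi_null_on_spheres psiE1 A1 \<longleftrightarrow> locally_strongly_condensing psiE psiE1 u1 f) \<and>
      (locally_strongly_condensing psiE psiE1 u1 f \<longleftrightarrow>
        locally_strongly_condensing_on_spheres psiE psiE1 u1 f))
    \<and> (\<forall>(f::'a \<Rightarrow> 'b) A1 A0.
      continuous_on UNIV f \<and>
      (\<exists>R. \<forall>u. norm u > R \<longrightarrow> f u = A1 u + A0 u) \<and>
      strongly_condensing_at_infinity_on_interlayers psiE psiE1 A0 \<and>
      continuous_on UNIV A1 \<and>
      (\<exists>k\<ge>1. psi_homogeneous psiE1 k A1) \<longrightarrow>
      (psi_null_on_spheres psiE1 A1 \<longleftrightarrow>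
        strongly_condensing_at_infinity_on_interlayers psiE psiE1 f) \<and>
      (strongly_condensing_at_infinity_on_interlayers psiE psiE1 f \<longleftrightarrow>
        strongly_condensing_at_infinity_on_spheres psiE psiE1 f))"
proof ((rule conjI; intro allI impI), goal_cases)
  case (1 u1 f A1 A0)
  then obtain \<delta> k where "\<delta> > 0" "\<And>u. norm u < \<delta> \<Longrightarrow> f (u1 + u) = A1 u + A0 u"
    and "k \<le> 1" "psi_homogeneous psiE1 k A1"
    by blast
  \<comment> \<open>Nullness implies both condensing conditions and follows from either one, which
    gives all the equivalences; the case of infinity closes in the same way.\<close>
  with 1 show ?case
    using locally_strongly_condensing_if_null[OF assms, of f A1 \<delta> u1 A0]
      null_if_locally_strongly_condensing[OF assms(1,2), of \<delta> f u1 A1 A0 k]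
    by blast
next
  case (2 f A1 A0)
  then obtain R k where "\<And>u. norm u > R \<Longrightarrow> f u = A1 u + A0 u"
    and "k \<ge> 1" "psi_homogeneous psiE1 k A1"
    by blast
  with 2 show ?case
    using strongly_condensing_at_infinity_if_null[OF assms, of f A1 R A0]
      null_if_strongly_condensing_at_infinity[OF assms(1,2), of R f A1 A0 k]
    by blast
qed

end
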